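(* Let $n\ge 2$ be an integer and let $\lambda>0$ be a real number such that $m=n^{\lambda}$ is an integer. Let $a,b$ be independent random variables, each uniformly distributed on $\{1,2,\dots,n\}$. Let $A$ be the end point of a simple symmetric random walk on $\mathbb{Z}$ with $m$ steps started at $a$, and let $B$ be the end point of a simple symmetric random walk on $\mathbb{Z}$ with $m$ steps started at $b$, where the steps of the two walks are independent of each other and of $(a,b)$. Then for every real $$\alpha\in\left(\tfrac12,\ \min\left\{1,\ \frac{\ln(n/2)}{\lambda\ln n}\right\}\right)$$ one has $$P(a<b\mid A<B)\ \ge\ \left(1-\exp\left(-\frac{m^{2\alpha-1}}{2}\right)\right)^2\left(\frac{(n-2m^{\alpha}+1)(n-2m^{\alpha})}{n^2-n}\right)\left(1-\frac1n\right).$$ Moreover, for every fixed $\lambda\in(0,2)$ and every fixed $\alpha\in\left(\tfrac12,\min\{1,1/\lambda\}\right)$, the right-hand side, with $m=n^{\lambda}$, tends to $1$ as $n\to\infty$.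
   Context: A simple symmetric random walk on $\mathbb{Z}$ with $m$ steps started at $x$ has end point $x+X_1+\cdots+X_m$, where $X_1,\dots,X_m$ are independent and each $X_i$ equals $1$ or $-1$ with probability $1/2$ each. *)

theory Defs
  imports "HOL-Probability.Probability"
begin

text \<open>Names for the random variables of the experiment, so that their joint independence can be
  expressed as the independence of a single family.\<close>

datatype walk_var = Start_A | Start_B | Step_A nat | Step_B nat

definition walk_end :: "('w \<Rightarrow> int) \<Rightarrow> (nat \<Rightarrow> 'w \<Rightarrow> int) \<Rightarrow> nat \<Rightarrow> 'w \<Rightarrow> int" where
  "walk_end x X m \<omega> = x \<omega> + (\<Sum>i=1..m. X i \<omega>)"

text \<open>The locale is only meaningful for \<open>n \<ge> 1\<close>, because \<^term>\<open>pmf_of_set {}\<close> is unspecified.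
  Measurability of all the variables is part of \<open>indep_vars\<close>.\<close>

locale two_random_walks = prob_space M for M :: "'w measure" +
  fixes n m :: nat
    and a b :: "'w \<Rightarrow> int"
    and X Y :: "nat \<Rightarrow> 'w \<Rightarrow> int"
  assumes indep: "indep_vars (\<lambda>_. count_space UNIV) (case_walk_var a b X Y)
      ({Start_A, Start_B} \<union> Step_A ` {1..m} \<union> Step_B ` {1..m})"
    and distr_a: "distr M (count_space UNIV) a = measure_pmf (pmf_of_set {1..int n})"
    and distr_b: "distr M (count_space UNIV) b = measure_pmf (pmf_of_set {1..int n})"
    and distr_X: "\<And>i. i \<in> {1..m} \<Longrightarrow>
      distr M (count_space UNIV) (X i) = measure_pmf (pmf_of_set {-1, 1})"
    and distr_Y: "\<And>i. i \<in> {1..m} \<Longrightarrow>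
      distr M (count_space UNIV) (Y i) = measure_pmf (pmf_of_set {-1, 1})"

text \<open>The number of steps \<open>m\<close> is a real argument here: in the limit \<open>n \<rightarrow> \<infinity>\<close> the bound is
  considered at \<open>m = n powr \<lambda>\<close> for every \<open>n\<close>, also where this is not an integer.\<close>

definition order_bound :: "real \<Rightarrow> real \<Rightarrow> real \<Rightarrow> real" where
  "order_bound n m \<alpha> =
     (1 - exp (- (m powr (2 * \<alpha> - 1) / 2)))\<^sup>2
     * (((n - 2 * m powr \<alpha> + 1) * (n - 2 * m powr \<alpha>)) / (n\<^sup>2 - n))
     * (1 - 1 / n)"

end

(*
  Let Z be the difference of the two displacements, so that A < B iff Z < b - a. Exchanging the two
  walks gives P(A < B) <= 1/2, hence it suffices to bound 2 P(a < b, A < B) = 2 P(b - a > max(0, Z))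
  from below. For integers z >= 0 the number of pairs (i, j) with j - i > z is (n - z)(n - z - 1)/2,
  cut off to 0 beyond n. This is convex in z, so it lies above its tangent at c = 2 m^alpha - 1,
  where its value is exactly the product (n - 2 m^alpha + 1)(n - 2 m^alpha)/2 of the claim. By
  independence and since E max(0, Z) <= c (second moment), the expectation of the tangent is at least
  its value at c. The factor (1 - exp(...))^2 is simply bounded by 1.
*)
theory Submission
  imports Defs "HOL-Real_Asymp.Real_Asymp"
begin

section \<open>Independent families\<close>

lemma (in prob_space) indep_vars_imp_indep_var:
  assumes "indep_vars N V I" "i \<in> I" "j \<in> I" "i \<noteq> j"
  shows "indep_var (N i) (V i) (N j) (V j)"
proof -
  have "indep_var (PiM {i} N) (\<lambda>\<omega>. restrict (\<lambda>k. V k \<omega>) {i}) (PiM {j} N) (\<lambda>\<omega>. restrict (\<lambda>k. V k \<omega>) {j})"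
    by (rule indep_var_restrict[OF assms(1)]) (use assms in auto)
  then have "indep_var (N i) ((\<lambda>v. v i) \<circ> (\<lambda>\<omega>. restrict (\<lambda>k. V k \<omega>) {i}))
      (N j) ((\<lambda>v. v j) \<circ> (\<lambda>\<omega>. restrict (\<lambda>k. V k \<omega>) {j}))"
    by (rule indep_var_compose) auto
  then show ?thesis by (simp add: comp_def)
qed

text \<open>In the expanded square every off-diagonal product has expectation zero, by independence
  and centring, so only the diagonal survives.\<close>

lemma (in prob_space) indep_vars_sum_second_moment:
  fixes W :: "'i \<Rightarrow> 'a \<Rightarrow> real"
  assumes fin: "finite J" and indep: "indep_vars (\<lambda>_. borel) W J"
    and int: "\<And>i. i \<in> J \<Longrightarrow> integrable M (W i)"
    and int2: "\<And>i. i \<in> J \<Longrightarrow> integrable M (\<lambda>\<omega>. W i \<omega> * W i \<omega>)"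
    and mean: "\<And>i. i \<in> J \<Longrightarrow> expectation (W i) = 0"
  shows "integrable M (\<lambda>\<omega>. (\<Sum>i\<in>J. W i \<omega>)\<^sup>2)"
    and "expectation (\<lambda>\<omega>. (\<Sum>i\<in>J. W i \<omega>)\<^sup>2) = (\<Sum>i\<in>J. expectation (\<lambda>\<omega>. W i \<omega> * W i \<omega>))"
proof -
  have sq: "(\<Sum>i\<in>J. W i \<omega>)\<^sup>2 = (\<Sum>i\<in>J. \<Sum>j\<in>J. W i \<omega> * W j \<omega>)" for \<omega>
    by (simp add: power2_eq_square sum_product)
  have prod_int: "integrable M (\<lambda>\<omega>. W i \<omega> * W j \<omega>)" if "i \<in> J" "j \<in> J" for i j
  proof (cases "i = j")
    case False
    from indep_vars_imp_indep_var[OF indep that False] show ?thesis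
      by (rule indep_var_integrable) (use that int in auto)
  qed (use that int2 in auto)
  have uncorrelated: "expectation (\<lambda>\<omega>. W i \<omega> * W j \<omega>) = 0" if "i \<in> J" "j \<in> J" "i \<noteq> j" for i j
    using indep_var_lebesgue_integral[OF indep_vars_imp_indep_var[OF indep that]] that int mean by simp
  show "integrable M (\<lambda>\<omega>. (\<Sum>i\<in>J. W i \<omega>)\<^sup>2)"
    unfolding sq using prod_int by auto
  have "expectation (\<lambda>\<omega>. (\<Sum>i\<in>J. W i \<omega>)\<^sup>2) = (\<Sum>i\<in>J. \<Sum>j\<in>J. expectation (\<lambda>\<omega>. W i \<omega> * W j \<omega>))"
    unfolding sq using prod_int by simp
  also have "\<dots> = (\<Sum>i\<in>J. \<Sum>j\<in>J. if i = j then expectation (\<lambda>\<omega>. W i \<omega> * W i \<omega>) else 0)"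
    using uncorrelated by (intro sum.cong refl) auto
  also have "\<dots> = (\<Sum>i\<in>J. expectation (\<lambda>\<omega>. W i \<omega> * W i \<omega>))"
    using fin by simp
  finally show "expectation (\<lambda>\<omega>. (\<Sum>i\<in>J. W i \<omega>)\<^sup>2) = (\<Sum>i\<in>J. expectation (\<lambda>\<omega>. W i \<omega> * W i \<omega>))" .
qed

text \<open>The joint law of an independent family is the product of its marginals, so renaming the
  indices by an injection of \<open>I\<close> into itself that matches marginals leaves it
  unchanged. This is what justifies exchanging the two walks.\<close>

lemma (in prob_space) indep_vars_joint_distr_reindex:
  assumes ne: "I \<noteq> {}" and indep: "indep_vars (\<lambda>_. N) V I"
    and f: "inj_on f I" "f \<in> I \<rightarrow> I"
    and eq: "\<And>i. i \<in> I \<Longrightarrow> distr M N (V (f i)) = distr M N (V i)"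
  shows "distr M (PiM I (\<lambda>_. N)) (\<lambda>\<omega>. \<lambda>i\<in>I. V (f i) \<omega>) = distr M (PiM I (\<lambda>_. N)) (\<lambda>\<omega>. \<lambda>i\<in>I. V i \<omega>)"
proof -
  have rv: "random_variable N (V i)" if "i \<in> I" for i
    using indep that by (auto simp: indep_vars_def)
  let ?D = "\<lambda>i. distr M N (V i)"
  have joint: "distr M (PiM I (\<lambda>_. N)) (\<lambda>\<omega>. \<lambda>i\<in>I. V i \<omega>) = PiM I ?D"
    using indep indep_vars_iff_distr_eq_PiM'[OF ne, of V "\<lambda>_. N"] rv by simp
  have PiM_eq: "PiM I (\<lambda>i. ?D (f i)) = PiM I ?D"
    by (rule PiM_cong) (auto simp: eq)
  \<comment> \<open>Under the product measure, the coordinates selected by the injection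
    \<open>f\<close> have the product law with factors \<open>?D (f i)\<close>, which by
    \<open>PiM_eq\<close> is \<open>PiM I ?D\<close> again.\<close>
  have "PiM I ?D = distr (PiM I ?D) (PiM I (\<lambda>i. ?D (f i))) (\<lambda>v. \<lambda>i\<in>I. v (f i))"
    using PiM_eq by (subst distr_PiM_reindex) (auto simp: f intro!: prob_space_distr rv)
  also have "\<dots> = distr (distr M (PiM I (\<lambda>_. N)) (\<lambda>\<omega>. \<lambda>i\<in>I. V i \<omega>)) (PiM I (\<lambda>_. N)) (\<lambda>v. \<lambda>i\<in>I. v (f i))"
    unfolding joint by (rule distr_cong) (auto intro!: sets_PiM_cong)
  also have "\<dots> = distr M (PiM I (\<lambda>_. N)) ((\<lambda>v. \<lambda>i\<in>I. v (f i)) \<circ> (\<lambda>\<omega>. \<lambda>i\<in>I. V i \<omega>))"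
    using f(2) by (intro distr_distr measurable_restrict measurable_component_singleton rv) auto
  also have "(\<lambda>v. \<lambda>i\<in>I. v (f i)) \<circ> (\<lambda>\<omega>. \<lambda>i\<in>I. V i \<omega>) = (\<lambda>\<omega>. \<lambda>i\<in>I. V (f i) \<omega>)"
    using f(2) by (auto simp: fun_eq_iff)
  finally show ?thesis unfolding joint by (rule sym)
qed

section \<open>Counting ordered pairs by their gap\<close>

text \<open>Natural subtraction turns the terms with i <= k into 0, leaving 0 + 1 + ... + (n - k -
  1). The cutoff matters: the quadratic vanishes at k = n - 1 and k = n but is positive again for
  larger k.\<close>

lemma sum_truncated_diff:
  "2 * real (\<Sum>i<n. i - k) = (if k \<le> n then (real n - real k) * (real n - real k - 1) else 0)"
  by (induction n) (auto simp: of_nat_diff algebra_simps le_Suc_eq)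

text \<open>For fixed i there are n - i - k choices of j, cut off at 0; summing over n - i instead
  of i gives the right-hand side.\<close>

lemma card_pairs_gap:
  "card {(i, j). i \<in> {1..int n} \<and> j \<in> {1..int n} \<and> int k < j - i} = (\<Sum>i<n. i - k)"
proof -
  have "{(i, j). i \<in> {1..int n} \<and> j \<in> {1..int n} \<and> int k < j - i}
      = (SIGMA i:{1..int n}. {i + int k + 1..int n})"
    by auto
  then have "card {(i, j). i \<in> {1..int n} \<and> j \<in> {1..int n} \<and> int k < j - i}
      = (\<Sum>i\<in>{1..int n}. nat (int n - i - int k))"
    by (simp add: algebra_simps)
  also have "\<dots> = (\<Sum>i<n. i - k)"
    by (rule sum.reindex_bij_witness[of _ "\<lambda>l. int n - int l" "\<lambda>i. nat (int n - i)"]) auto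
  finally show ?thesis .
qed

lemma card_pairs_gap_ge_tangent:
  fixes z :: int
  assumes "0 \<le> z" "0 \<le> c" "c < real n - 1"
  shows "2 * real (card {(i, j). i \<in> {1..int n} \<and> j \<in> {1..int n} \<and> z < j - i})
    \<ge> (real n - c) * (real n - c - 1) + (2 * real n - 2 * c - 1) * (c - of_int z)"
proof -
  obtain k where k: "z = int k" using assms(1) nonneg_int_cases by blast
  \<comment> \<open>The right-hand side of this identity is the quadratic minus its excess over the
    tangent at \<open>c\<close>, which is exactly (x - c)^2. This settles the case k <= n.\<close>
  have tangent: "(real n - c) * (real n - c - 1) + (2 * real n - 2 * c - 1) * (c - x)
      = (real n - x) * (real n - x - 1) - (x - c)\<^sup>2" for x
    by (simp add: algebra_simps power2_eq_square)
  have "2 * real (\<Sum>i<n. i - k) \<ge>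
      (real n - c) * (real n - c - 1) + (2 * real n - 2 * c - 1) * (c - real k)"
  proof (cases "k \<le> n")
    case True
    then show ?thesis unfolding tangent sum_truncated_diff by simp
  next
    case False
    \<comment> \<open>Beyond n the count is 0. The tangent decreases because c < n - 1, so there it
      lies below its value at n, which is -(n - c)^2.\<close>
    have "(2 * real n - 2 * c - 1) * (c - real k) \<le> (2 * real n - 2 * c - 1) * (c - real n)"
      using False assms by (intro mult_left_mono) auto
    with tangent[of "real n"] False show ?thesis
      unfolding sum_truncated_diff by (simp add: le_diff_eq) (smt (verit) zero_le_power2)
  qed
  then show ?thesis unfolding k card_pairs_gap by simp
qed

section \<open>The two walks\<close>

definition walk_steps :: "nat \<Rightarrow> walk_var set" where
  "walk_steps m = Step_A ` {1..m} \<union> Step_B ` {1..m}"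

context two_random_walks
begin

abbreviation "V \<equiv> case_walk_var a b X Y"

abbreviation "vars \<equiv> {Start_A, Start_B} \<union> walk_steps m"

definition displacement_diff :: "'w \<Rightarrow> int" where
  "displacement_diff \<omega> = (\<Sum>i=1..m. X i \<omega>) - (\<Sum>i=1..m. Y i \<omega>)"

lemma walk_end_less_iff: "walk_end a X m \<omega> < walk_end b Y m \<omega> \<longleftrightarrow> displacement_diff \<omega> < b \<omega> - a \<omega>"
  by (auto simp: walk_end_def displacement_diff_def)

lemma indep_V: "indep_vars (\<lambda>_. count_space UNIV) V vars"
  using indep by (simp add: walk_steps_def Un_assoc)

lemma measurable_V: "v \<in> vars \<Longrightarrow> V v \<in> measurable M (count_space UNIV)"
  using indep_V by (auto simp: indep_vars_def)

lemma measurable_start [measurable]: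
  "a \<in> measurable M (count_space UNIV)" "b \<in> measurable M (count_space UNIV)"
  using measurable_V[of Start_A] measurable_V[of Start_B] by simp_all

lemma measurable_step:
  "i \<in> {1..m} \<Longrightarrow> X i \<in> measurable M (count_space UNIV)"
  "i \<in> {1..m} \<Longrightarrow> Y i \<in> measurable M (count_space UNIV)"
  using measurable_V[of "Step_A i"] measurable_V[of "Step_B i"] by (auto simp: walk_steps_def)

lemma real_displacement_diff_measurable:
  "(\<lambda>\<omega>. real_of_int (displacement_diff \<omega>)) \<in> borel_measurable M"
  unfolding displacement_diff_def of_int_diff of_int_sum
  by (intro borel_measurable_diff borel_measurable_sum measurable_compose[OF measurable_step(1)]
      measurable_compose[OF measurable_step(2)]) auto

lemma displacement_diff_measurable [measurable]:
  "displacement_diff \<in> measurable M (count_space UNIV)"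
proof -
  \<comment> \<open>Sums are handled as Borel functions; taking the floor brings measurability back
    to the integers.\<close>
  have "(\<lambda>\<omega>. \<lfloor>real_of_int (displacement_diff \<omega>)\<rfloor>) \<in> measurable M (count_space UNIV)"
    using real_displacement_diff_measurable by measurable
  then show ?thesis by simp
qed

section \<open>Symmetry under exchange of the walks\<close>

lemma prob_walk_end_less_le_half:
  "prob {\<omega> \<in> space M. walk_end a X m \<omega> < walk_end b Y m \<omega>} \<le> 1 / 2"
proof -
  \<comment> \<open>\<open>f\<close> swaps each variable with its counterpart in the other walk. It
    preserves the marginals, hence the joint law, while it reverses the inequality that defines
    \<open>E\<close>.\<close>
  define f where "f = case_walk_var Start_B Start_A Step_B Step_A"
  let ?P = "PiM vars (\<lambda>_. count_space UNIV :: int measure)"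
  \<comment> \<open>The comparison is made between real numbers so that the Borel measurability
    rules for sums apply.\<close>
  define E where "E = {v \<in> space ?P. real_of_int (v Start_A) + (\<Sum>i=1..m. real_of_int (v (Step_A i)))
      < real_of_int (v Start_B) + (\<Sum>i=1..m. real_of_int (v (Step_B i)))}"
  have comp: "(\<lambda>v. real_of_int (v k)) \<in> borel_measurable ?P" if "k \<in> vars" for k
    by (rule measurable_compose[OF measurable_component_singleton[OF that]]) simp
  have E: "E \<in> sets ?P"
    unfolding E_def
    by (intro borel_measurable_less borel_measurable_add borel_measurable_sum comp)
      (auto simp: walk_steps_def)
  have rv: "(\<lambda>\<omega>. \<lambda>i\<in>vars. V (g i) \<omega>) \<in> measurable M ?P" if "g \<in> vars \<rightarrow> vars" for g
    using that by (intro measurable_restrict measurable_V) auto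
  have inj: "inj_on f vars" by (auto simp: inj_on_def f_def split: walk_var.splits)
  have f: "f \<in> vars \<rightarrow> vars" by (auto simp: f_def walk_steps_def)
  have "distr M (count_space UNIV) (V (f i)) = distr M (count_space UNIV) (V i)" if "i \<in> vars" for i
    using that by (auto simp: f_def walk_steps_def distr_a distr_b distr_X distr_Y)
  then have "distr M ?P (\<lambda>\<omega>. \<lambda>i\<in>vars. V (f i) \<omega>) = distr M ?P (\<lambda>\<omega>. \<lambda>i\<in>vars. V i \<omega>)"
    by (intro indep_vars_joint_distr_reindex indep_V inj f) auto
  then have "measure (distr M ?P (\<lambda>\<omega>. \<lambda>i\<in>vars. V (f i) \<omega>)) E = measure (distr M ?P (\<lambda>\<omega>. \<lambda>i\<in>vars. V i \<omega>)) E"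
    by simp
  then have "prob ((\<lambda>\<omega>. \<lambda>i\<in>vars. V (f i) \<omega>) -` E \<inter> space M) = prob ((\<lambda>\<omega>. \<lambda>i\<in>vars. V i \<omega>) -` E \<inter> space M)"
    using rv[OF f] rv[of id] E by (simp add: measure_distr)
  moreover have "(\<lambda>\<omega>. \<lambda>i\<in>vars. V i \<omega>) -` E \<inter> space M = {\<omega> \<in> space M. walk_end a X m \<omega> < walk_end b Y m \<omega>}"
  proof -
    have "(\<lambda>i\<in>vars. V i \<omega>) \<in> E \<longleftrightarrow> real_of_int (walk_end a X m \<omega>) < real_of_int (walk_end b Y m \<omega>)" for \<omega>
      by (simp add: E_def space_PiM walk_end_def walk_steps_def del: of_int_less_iff)
    then show ?thesis by auto
  qed
  moreover have "(\<lambda>\<omega>. \<lambda>i\<in>vars. V (f i) \<omega>) -` E \<inter> space M = {\<omega> \<in> space M. walk_end b Y m \<omega> < walk_end a X m \<omega>}"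
  proof -
    have "(\<lambda>i\<in>vars. V (f i) \<omega>) \<in> E \<longleftrightarrow> real_of_int (walk_end b Y m \<omega>) < real_of_int (walk_end a X m \<omega>)" for \<omega>
      by (simp add: E_def space_PiM walk_end_def walk_steps_def f_def del: of_int_less_iff)
    then show ?thesis by auto
  qed
  ultimately have sym: "prob {\<omega> \<in> space M. walk_end b Y m \<omega> < walk_end a X m \<omega>}
      = prob {\<omega> \<in> space M. walk_end a X m \<omega> < walk_end b Y m \<omega>}"
    by simp
  have ev: "{\<omega> \<in> space M. walk_end a X m \<omega> < walk_end b Y m \<omega>} \<in> events"
    unfolding walk_end_less_iff by measurable
  have ev': "{\<omega> \<in> space M. walk_end b Y m \<omega> < walk_end a X m \<omega>} \<in> events"
  proof -
    have "{\<omega> \<in> space M. walk_end b Y m \<omega> < walk_end a X m \<omega>}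
        = {\<omega> \<in> space M. b \<omega> - a \<omega> < displacement_diff \<omega>}"
      by (auto simp: walk_end_def displacement_diff_def)
    then show ?thesis by simp
  qed
  \<comment> \<open>The two strict events are disjoint and equally likely. Ties may have positive
    probability, so only an inequality results.\<close>
  have "prob {\<omega> \<in> space M. walk_end a X m \<omega> < walk_end b Y m \<omega>}
      + prob {\<omega> \<in> space M. walk_end b Y m \<omega> < walk_end a X m \<omega>}
      = prob ({\<omega> \<in> space M. walk_end a X m \<omega> < walk_end b Y m \<omega>}
        \<union> {\<omega> \<in> space M. walk_end b Y m \<omega> < walk_end a X m \<omega>})"
    by (rule finite_measure_Union[symmetric]) (use ev ev' in auto)
  also have "\<dots> \<le> 1" by (rule prob_le_1)
  finally show ?thesis using sym by simp
qed

section \<open>Moments of the displacement difference\<close>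

lemma step_integral:
  fixes g :: "int \<Rightarrow> real"
  assumes "v \<in> walk_steps m"
  shows "integrable M (\<lambda>\<omega>. g (V v \<omega>))" "expectation (\<lambda>\<omega>. g (V v \<omega>)) = (g 1 + g (-1)) / 2"
proof -
  have D: "distr M (count_space UNIV) (V v) = measure_pmf (pmf_of_set {-1, 1})"
    using assms by (auto simp: walk_steps_def distr_X distr_Y)
  have rv: "V v \<in> measurable M (count_space UNIV)"
    using assms by (intro measurable_V) simp
  have "integrable (distr M (count_space UNIV) (V v)) g"
    unfolding D by (rule integrable_measure_pmf_finite) simp
  with rv show "integrable M (\<lambda>\<omega>. g (V v \<omega>))"
    by (subst (asm) integrable_distr_eq) auto
  have "expectation (\<lambda>\<omega>. g (V v \<omega>)) = integral\<^sup>L (distr M (count_space UNIV) (V v)) g"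
    using rv by (simp add: integral_distr)
  also have "\<dots> = (g 1 + g (-1)) / 2"
    unfolding D by (subst integral_pmf_of_set) auto
  finally show "expectation (\<lambda>\<omega>. g (V v \<omega>)) = (g 1 + g (-1)) / 2" .
qed

lemma displacement_diff_moments:
  "integrable M (\<lambda>\<omega>. real_of_int (displacement_diff \<omega>))"
  "expectation (\<lambda>\<omega>. real_of_int (displacement_diff \<omega>)) = 0"
  "integrable M (\<lambda>\<omega>. (real_of_int (displacement_diff \<omega>))\<^sup>2)"
  "expectation (\<lambda>\<omega>. (real_of_int (displacement_diff \<omega>))\<^sup>2) = 2 * real m"
proof -
  \<comment> \<open>The signs turn the difference of two sums into one sum over the independent
    family of all 2m steps, each summand being centred with variance 1. The default -1 also makes
    \<open>sg_sq\<close> hold for every index.\<close>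
  define sg :: "walk_var \<Rightarrow> real" where "sg v = (case v of Step_A i \<Rightarrow> 1 | _ \<Rightarrow> - 1)" for v
  define W where "W v \<omega> = sg v * real_of_int (V v \<omega>)" for v \<omega>
  have fin: "finite (walk_steps m)" by (simp add: walk_steps_def)
  have disj: "Step_A ` {1..m} \<inter> Step_B ` {1..m} = {}" by auto
  have eq: "real_of_int (displacement_diff \<omega>) = (\<Sum>v\<in>walk_steps m. W v \<omega>)" for \<omega>
    unfolding walk_steps_def using disj
    by (simp add: sum.union_disjoint sum.reindex inj_on_def W_def sg_def displacement_diff_def sum_negf)
  have int: "integrable M (W v)" and mean: "expectation (W v) = 0" if "v \<in> walk_steps m" for v
    using step_integral[OF that, of "\<lambda>x. sg v * real_of_int x"] unfolding W_def by simp_all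
  have sg_sq: "sg v * sg v = 1" for v by (simp add: sg_def split: walk_var.splits)
  have int2: "integrable M (\<lambda>\<omega>. W v \<omega> * W v \<omega>)" and var: "expectation (\<lambda>\<omega>. W v \<omega> * W v \<omega>) = 1"
    if "v \<in> walk_steps m" for v
    using step_integral[OF that, of "\<lambda>x. sg v * real_of_int x * (sg v * real_of_int x)"]
    unfolding W_def by (simp_all add: sg_sq)
  have "indep_vars (\<lambda>_. count_space UNIV) V (walk_steps m)"
    by (rule indep_vars_subset[OF indep_V]) auto
  then have indep: "indep_vars (\<lambda>_. borel) W (walk_steps m)"
    unfolding W_def by (rule indep_vars_compose2) auto
  show "integrable M (\<lambda>\<omega>. real_of_int (displacement_diff \<omega>))"
    unfolding eq using int by auto
  show "expectation (\<lambda>\<omega>. real_of_int (displacement_diff \<omega>)) = 0"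
    unfolding eq using int mean by simp
  show "integrable M (\<lambda>\<omega>. (real_of_int (displacement_diff \<omega>))\<^sup>2)"
    unfolding eq by (rule indep_vars_sum_second_moment(1)[OF fin indep int int2 mean])
  have "card (walk_steps m) = 2 * m"
    unfolding walk_steps_def using disj by (simp add: card_Un_disjoint card_image inj_on_def)
  then show "expectation (\<lambda>\<omega>. (real_of_int (displacement_diff \<omega>))\<^sup>2) = 2 * real m"
    unfolding eq indep_vars_sum_second_moment(2)[OF fin indep int int2 mean, simplified] by (simp add: var)
qed

text \<open>The positive part is dominated by a parabola in the displacement difference, whose
  expectation is determined by the first two moments. The parameter \<open>t\<close> stays free to
  be matched to the scale of the walk.\<close>

lemma expectation_pos_displacement_diff_le:
  assumes "t > 0"
  shows "integrable M (\<lambda>\<omega>. real_of_int (max 0 (displacement_diff \<omega>)))"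
    and "expectation (\<lambda>\<omega>. real_of_int (max 0 (displacement_diff \<omega>))) \<le> (2 * real m + t\<^sup>2) / (4 * t)"
proof -
  let ?Z = "\<lambda>\<omega>. real_of_int (displacement_diff \<omega>)"
  let ?q = "\<lambda>\<omega>. ((?Z \<omega>)\<^sup>2 + 2 * t * ?Z \<omega> + t\<^sup>2) / (4 * t)"
  \<comment> \<open>Completing the square on the right gives \<open>(z + t)\<^sup>2 / (4 * t)\<close>, which exceeds \<open>z\<close> by \<open>(z - t)\<^sup>2 / (4 * t)\<close>.\<close>
  have le: "max 0 z \<le> (z\<^sup>2 + 2 * t * z + t\<^sup>2) / (4 * t)" for z
  proof -
    have "0 \<le> (z + t)\<^sup>2" "0 \<le> (z - t)\<^sup>2" by simp_all
    with assms show ?thesis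
      by (auto simp: max_def field_simps power2_eq_square)
  qed
  have intq: "integrable M ?q"
    using displacement_diff_moments by auto
  show int: "integrable M (\<lambda>\<omega>. real_of_int (max 0 (displacement_diff \<omega>)))"
    unfolding of_int_max using displacement_diff_moments(1) by simp
  have "expectation (\<lambda>\<omega>. real_of_int (max 0 (displacement_diff \<omega>))) \<le> expectation ?q"
    by (intro integral_mono int intq) (simp only: of_int_max of_int_0 le)
  also have "\<dots> = (2 * real m + t\<^sup>2) / (4 * t)"
    using displacement_diff_moments by (simp add: prob_space)
  finally show "expectation (\<lambda>\<omega>. real_of_int (max 0 (displacement_diff \<omega>))) \<le> (2 * real m + t\<^sup>2) / (4 * t)" .
qed

section \<open>Joint law of the starts and the displacement difference\<close>

lemma prob_start_eq:
  assumes "i \<in> {1..int n}"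
  shows "prob (a -` {i} \<inter> space M) = 1 / real n" "prob (b -` {i} \<inter> space M) = 1 / real n"
  using assms measure_distr[OF measurable_start(1), of "{i}"] measure_distr[OF measurable_start(2), of "{i}"]
  by (simp_all add: distr_a distr_b measure_pmf_single)

text \<open>The starts and the steps are disjoint blocks of one independent family, and the
  displacement difference depends on the steps alone. The factor 1/n^2 is the probability of the
  pair of starts.\<close>

lemma prob_starts_displacement:
  assumes "i \<in> {1..int n}" "j \<in> {1..int n}"
  shows "prob {\<omega> \<in> space M. a \<omega> = i \<and> b \<omega> = j \<and> displacement_diff \<omega> < k}
    = prob {\<omega> \<in> space M. displacement_diff \<omega> < k} / (real n)\<^sup>2"
proof -
  let ?N = "\<lambda>_::walk_var. count_space UNIV :: int measure"
  let ?S = "{Start_A, Start_B}" and ?T = "walk_steps m"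
  have comp: "(\<lambda>v. real_of_int (v l)) \<in> borel_measurable (PiM I ?N)" if "l \<in> I" for l I
    by (rule measurable_compose[OF measurable_component_singleton[OF that]]) simp
  have joint: "indep_var (PiM ?S ?N) (\<lambda>\<omega>. restrict (\<lambda>v. V v \<omega>) ?S) (PiM ?T ?N) (\<lambda>\<omega>. restrict (\<lambda>v. V v \<omega>) ?T)"
    by (rule indep_var_restrict[OF indep_V]) (auto simp: walk_steps_def)
  define E1 where "E1 = {v \<in> space (PiM ?S ?N). real_of_int (v Start_A) = of_int i \<and> real_of_int (v Start_B) = of_int j}"
  define E2 where "E2 = {v \<in> space (PiM ?T ?N).
    (\<Sum>i=1..m. real_of_int (v (Step_A i))) - (\<Sum>i=1..m. real_of_int (v (Step_B i))) < of_int k}"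
  have E1: "E1 \<in> sets (PiM ?S ?N)"
    unfolding E1_def by (intro sets.sets_Collect_conj borel_measurable_eq comp) auto
  have E2: "E2 \<in> sets (PiM ?T ?N)"
    unfolding E2_def by (intro borel_measurable_less borel_measurable_diff borel_measurable_sum comp)
      (auto simp: walk_steps_def)
  have in_E1: "restrict (\<lambda>v. V v \<omega>) ?S \<in> E1 \<longleftrightarrow> a \<omega> = i \<and> b \<omega> = j" for \<omega>
    by (simp add: E1_def space_PiM)
  have in_E2: "restrict (\<lambda>v. V v \<omega>) ?T \<in> E2 \<longleftrightarrow> displacement_diff \<omega> < k" for \<omega>
  proof -
    have "restrict (\<lambda>v. V v \<omega>) ?T \<in> E2 \<longleftrightarrow> real_of_int (displacement_diff \<omega>) < of_int k"
      by (simp add: E2_def space_PiM displacement_diff_def walk_steps_def del: of_int_less_iff)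
    then show ?thesis by simp
  qed
  have "indep_var (count_space UNIV) a (count_space UNIV) b"
    using indep_vars_imp_indep_var[OF indep_V, of Start_A Start_B] by simp
  from indep_varD[OF this, of "{i}" "{j}"]
  have "prob ((\<lambda>\<omega>. (a \<omega>, b \<omega>)) -` ({i} \<times> {j}) \<inter> space M) = 1 / (real n)\<^sup>2"
    using assms by (simp add: prob_start_eq power2_eq_square)
  moreover have "(\<lambda>\<omega>. (a \<omega>, b \<omega>)) -` ({i} \<times> {j}) \<inter> space M = {\<omega> \<in> space M. a \<omega> = i \<and> b \<omega> = j}"
    by auto
  ultimately have starts: "prob {\<omega> \<in> space M. a \<omega> = i \<and> b \<omega> = j} = 1 / (real n)\<^sup>2"
    by simp
  from indep_varD[OF joint E1 E2] have
    "prob {\<omega> \<in> space M. (a \<omega> = i \<and> b \<omega> = j) \<and> displacement_diff \<omega> < k} =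
      prob {\<omega> \<in> space M. a \<omega> = i \<and> b \<omega> = j} * prob {\<omega> \<in> space M. displacement_diff \<omega> < k}"
    unfolding vimage_def mem_Times_iff Int_def fst_conv snd_conv mem_Collect_eq in_E1 in_E2
    by (simp only: conj_commute)
  then show ?thesis by (simp add: starts)
qed

section \<open>Lower bound for the conditional probability\<close>

lemma prob_both_less_ge:
  assumes c: "0 \<le> c" "c < real n - 1" and t: "t > 0" "(2 * real m + t\<^sup>2) / (4 * t) \<le> c"
  shows "prob {\<omega> \<in> space M. a \<omega> < b \<omega> \<and> walk_end a X m \<omega> < walk_end b Y m \<omega>}
    \<ge> (real n - c) * (real n - c - 1) / (2 * (real n)\<^sup>2)"
proof -
  let ?Z = displacement_diff
  let ?P = "{1..int n} \<times> {1..int n}"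
  define Q where "Q = {p \<in> ?P. fst p < snd p}"
  define F where "F p = {\<omega> \<in> space M. a \<omega> = fst p \<and> b \<omega> = snd p \<and> ?Z \<omega> < snd p - fst p}" for p
  have finQ: "finite Q" by (simp add: Q_def)
  \<comment> \<open>The event is split according to the pair of starts, each pair in
    \<open>Q\<close> contributing one of the disjoint events \<open>F p\<close>.\<close>
  have "(\<Sum>p\<in>Q. prob {\<omega> \<in> space M. ?Z \<omega> < snd p - fst p} / (real n)\<^sup>2) = (\<Sum>p\<in>Q. prob (F p))"
    unfolding F_def by (intro sum.cong refl prob_starts_displacement[symmetric]) (auto simp: Q_def)
  also have "\<dots> = prob (\<Union>p\<in>Q. F p)"
    by (rule finite_measure_finite_Union[symmetric])
      (auto simp: finQ disjoint_family_on_def F_def)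
  also have "\<dots> \<le> prob {\<omega> \<in> space M. a \<omega> < b \<omega> \<and> walk_end a X m \<omega> < walk_end b Y m \<omega>}"
    by (rule finite_measure_mono) (auto simp: F_def Q_def walk_end_less_iff)
  finally have lower: "(\<Sum>p\<in>Q. prob {\<omega> \<in> space M. ?Z \<omega> < snd p - fst p}) / (real n)\<^sup>2
      \<le> prob {\<omega> \<in> space M. a \<omega> < b \<omega> \<and> walk_end a X m \<omega> < walk_end b Y m \<omega>}"
    by (simp add: sum_divide_distrib)
  define N where "N z = real (card {(i, j). i \<in> {1..int n} \<and> j \<in> {1..int n} \<and> z < j - i})" for z
  have ind_int: "integrable M (indicator {\<omega> \<in> space M. ?Z \<omega> < snd p - fst p} :: 'w \<Rightarrow> real)" for p :: "int \<times> int"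
    by (simp add: integrable_indicator_iff less_top[symmetric])
  \<comment> \<open>For a fixed outcome, the conditions 0 < j - i from \<open>Q\<close> and Z < j -
    i merge into max(0, Z) < j - i, so the sum of indicators is the gap count at a nonnegative
    integer.\<close>
  have count: "(\<Sum>p\<in>Q. indicator {\<omega> \<in> space M. ?Z \<omega> < snd p - fst p} \<omega>) = N (max 0 (?Z \<omega>))"
    if "\<omega> \<in> space M" for \<omega>
  proof -
    have "(\<Sum>p\<in>Q. indicator {\<omega> \<in> space M. ?Z \<omega> < snd p - fst p} \<omega> :: real)
        = real (card {p \<in> Q. ?Z \<omega> < snd p - fst p})"
      using that finQ by (simp add: indicator_def sum.If_cases Int_def)
    also have "{p \<in> Q. ?Z \<omega> < snd p - fst p}
        = {(i, j). i \<in> {1..int n} \<and> j \<in> {1..int n} \<and> max 0 (?Z \<omega>) < j - i}"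
      by (auto simp: Q_def)
    finally show ?thesis by (simp add: N_def)
  qed
  have "(\<Sum>p\<in>Q. prob {\<omega> \<in> space M. ?Z \<omega> < snd p - fst p})
      = expectation (\<lambda>\<omega>. \<Sum>p\<in>Q. indicator {\<omega> \<in> space M. ?Z \<omega> < snd p - fst p} \<omega>)"
    using ind_int by (subst Bochner_Integration.integral_sum) auto
  also have "\<dots> = expectation (\<lambda>\<omega>. N (max 0 (?Z \<omega>)))"
    by (rule Bochner_Integration.integral_cong) (auto simp: count)
  finally have sum_eq: "(\<Sum>p\<in>Q. prob {\<omega> \<in> space M. ?Z \<omega> < snd p - fst p})
      = expectation (\<lambda>\<omega>. N (max 0 (?Z \<omega>)))" .
  have N_int: "integrable M (\<lambda>\<omega>. N (max 0 (?Z \<omega>)))"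
  proof -
    have "integrable M (\<lambda>\<omega>. \<Sum>p\<in>Q. indicator {\<omega> \<in> space M. ?Z \<omega> < snd p - fst p} \<omega> :: real)"
      using ind_int by auto
    then show ?thesis
      by (subst Bochner_Integration.integrable_cong[OF refl count[symmetric]])
  qed
  let ?L = "\<lambda>\<omega>. ((real n - c) * (real n - c - 1)
    + (2 * real n - 2 * c - 1) * (c - real_of_int (max 0 (?Z \<omega>)))) / 2"
  note pos = expectation_pos_displacement_diff_le[OF t(1)]
  \<comment> \<open>The added term is nonnegative: 2n - 2c - 1 > 0, and the expected positive part
    is at most \<open>c\<close>. Being affine, the tangent then commutes with the
    expectation.\<close>
  have "(real n - c) * (real n - c - 1) / 2 \<le> ((real n - c) * (real n - c - 1)
      + (2 * real n - 2 * c - 1) * (c - expectation (\<lambda>\<omega>. real_of_int (max 0 (?Z \<omega>))))) / 2"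
    using c t(2) pos(2) by simp
  also have "\<dots> = expectation ?L"
    using pos(1) by (simp add: prob_space del: of_int_max)
  also have "\<dots> \<le> expectation (\<lambda>\<omega>. N (max 0 (?Z \<omega>)))"
  proof (rule integral_mono[OF _ N_int])
    show "integrable M ?L" using pos(1) by (simp del: of_int_max)
    show "?L \<omega> \<le> N (max 0 (?Z \<omega>))" for \<omega>
      using card_pairs_gap_ge_tangent[of "max 0 (?Z \<omega>)" c n] c by (simp add: N_def)
  qed
  finally have "(real n - c) * (real n - c - 1) / 2 / (real n)\<^sup>2
      \<le> (\<Sum>p\<in>Q. prob {\<omega> \<in> space M. ?Z \<omega> < snd p - fst p}) / (real n)\<^sup>2"
    unfolding sum_eq by (rule divide_right_mono) simp
  with lower show ?thesis by simp
qed

lemma cond_prob_ge: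
  assumes c: "0 \<le> c" "c < real n - 1" and t: "t > 0" "(2 * real m + t\<^sup>2) / (4 * t) \<le> c"
  shows "\<P>(\<omega> in M. a \<omega> < b \<omega> \<bar> walk_end a X m \<omega> < walk_end b Y m \<omega>)
    \<ge> (real n - c) * (real n - c - 1) / (real n)\<^sup>2"
proof -
  let ?p = "prob {\<omega> \<in> space M. walk_end a X m \<omega> < walk_end b Y m \<omega>}"
  let ?q = "prob {\<omega> \<in> space M. a \<omega> < b \<omega> \<and> walk_end a X m \<omega> < walk_end b Y m \<omega>}"
  have q: "(real n - c) * (real n - c - 1) / (real n)\<^sup>2 \<le> 2 * ?q"
    using prob_both_less_ge[OF assms] by simp
  \<comment> \<open>Positivity passes from the bound to \<open>?q\<close> and thence to
    \<open>?p\<close>. Without it the quotient could be 0/0, which is 0 by convention, and the bound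
    \<open>?p\<close> <= 1/2 would give nothing.\<close>
  have "0 < (real n - c) * (real n - c - 1) / (real n)\<^sup>2"
    using c by (intro divide_pos_pos mult_pos_pos) auto
  with q have "0 < ?q" by simp
  moreover have "?q \<le> ?p"
    by (rule finite_measure_mono) (auto simp: walk_end_less_iff)
  ultimately have "2 * ?q \<le> ?q / ?p"
    using prob_walk_end_less_le_half by (simp add: field_simps)
  with q show ?thesis by (simp add: cond_prob_def)
qed

end

section \<open>The bound\<close>

text \<open>Since n^2 - n = n^2 (1 - 1/n), the last factor of the bound cancels against the
  denominator.\<close>

lemma order_bound_eq:
  assumes "n > 1"
  shows "order_bound n m \<alpha> = (1 - exp (- (m powr (2 * \<alpha> - 1) / 2)))\<^sup>2
    * ((n - 2 * m powr \<alpha> + 1) * (n - 2 * m powr \<alpha>) / n\<^sup>2)"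
proof -
  have "order_bound n m \<alpha> = (1 - exp (- (m powr (2 * \<alpha> - 1) / 2)))\<^sup>2
      * ((n - 2 * m powr \<alpha> + 1) * (n - 2 * m powr \<alpha>) * ((1 - 1 / n) / (n\<^sup>2 - n)))"
    by (simp add: order_bound_def)
  also have "(1 - 1 / n) / (n\<^sup>2 - n) = 1 / n\<^sup>2"
    using assms by (simp add: field_simps power2_eq_square)
  finally show ?thesis by simp
qed

lemma cond_prob_ge_order_bound:
  assumes walks: "two_random_walks M n m a b X Y" and n: "n \<ge> 2" and lam: "lam > 0"
    and m: "real m = real n powr lam"
    and \<alpha>: "1 / 2 < \<alpha>" "\<alpha> < ln (real n / 2) / (lam * ln (real n))"
  shows "order_bound (real n) (real m) \<alpha>
    \<le> \<P>(\<omega> in M. a \<omega> < b \<omega> \<bar> walk_end a X m \<omega> < walk_end b Y m \<omega>)"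
proof -
  interpret two_random_walks M n m a b X Y by (rule walks)
  have "ln (real n) > 0" using n by simp
  \<comment> \<open>Exponentiating this form of the upper bound on \<alpha> gives 2 m^\<alpha> < n,
    which makes both factors of the product positive.\<close>
  with \<alpha>(2) lam have "\<alpha> * lam * ln (real n) < ln (real n / 2)"
    by (simp add: field_simps)
  moreover have s: "real m powr \<alpha> = exp (\<alpha> * lam * ln (real n))"
    using n by (simp add: m powr_powr powr_def mult_ac)
  ultimately have "real m powr \<alpha> < exp (ln (real n / 2))" by simp
  then have s_lt: "2 * real m powr \<alpha> < real n" using n by simp
  have m1: "real m \<ge> 1" unfolding m using n lam by (intro ge_one_powr_ge_zero) auto
  then have s_ge: "sqrt (real m) \<le> real m powr \<alpha>"
    using \<alpha>(1) by (simp flip: powr_half_sqrt add: powr_mono)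
  \<comment> \<open>With this choice n - c and n - c - 1 are exactly the two factors n - 2
    m^\<alpha> + 1 and n - 2 m^\<alpha> of the bound.\<close>
  define c where "c = 2 * real m powr \<alpha> - 1"
  have sqrt1: "sqrt (real m) \<ge> 1" using m1 by simp
  \<comment> \<open>The parameter t = sqrt m has the order of the standard deviation. The resulting
    3/4 sqrt m is at most 2 sqrt m - 1 because sqrt m >= 1, and sqrt m <= m^\<alpha> then gives
    \<open>c\<close>.\<close>
  have "(2 * real m + (sqrt (real m))\<^sup>2) / (4 * sqrt (real m)) = 3 / 4 * sqrt (real m)"
    using m1 by (simp add: field_simps)
  also have "\<dots> \<le> c"
    unfolding c_def using s_ge sqrt1 by linarith
  finally have moment: "(2 * real m + (sqrt (real m))\<^sup>2) / (4 * sqrt (real m)) \<le> c" .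
  have "(real n - c) * (real n - c - 1) / (real n)\<^sup>2
      \<le> \<P>(\<omega> in M. a \<omega> < b \<omega> \<bar> walk_end a X m \<omega> < walk_end b Y m \<omega>)"
  proof (rule cond_prob_ge[OF _ _ _ moment])
    show "0 \<le> c" using s_ge sqrt1 unfolding c_def by linarith
    show "c < real n - 1" using s_lt by (simp add: c_def)
    show "sqrt (real m) > 0" using sqrt1 by linarith
  qed
  moreover have "order_bound (real n) (real m) \<alpha> \<le> 1 * ((real n - c) * (real n - c - 1) / (real n)\<^sup>2)"
  proof -
    have "order_bound (real n) (real m) \<alpha>
        = (1 - exp (- (real m powr (2 * \<alpha> - 1) / 2)))\<^sup>2 * ((real n - c) * (real n - c - 1) / (real n)\<^sup>2)"
      using n by (simp add: order_bound_eq c_def algebra_simps)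
    also have "\<dots> \<le> 1 * ((real n - c) * (real n - c - 1) / (real n)\<^sup>2)"
      using s_lt by (intro mult_right_mono power_le_one divide_nonneg_nonneg mult_nonneg_nonneg)
        (auto simp: c_def)
    finally show ?thesis .
  qed
  ultimately show ?thesis by simp
qed

text \<open>Dividing each factor of the product by n leaves only 1/n and \<open>?x n\<close> =
  m^\<alpha> / n as corrections. The latter tends to 0 since lam * \<alpha> < 1, while the
  exponential dies out since 2 \<alpha> > 1.\<close>

lemma order_bound_tendsto_1:
  fixes lam \<alpha> :: real
  assumes lam: "0 < lam" and \<alpha>: "1 / 2 < \<alpha>" "\<alpha> < 1 / lam"
  shows "(\<lambda>n::nat. order_bound (real n) (real n powr lam) \<alpha>) \<longlonglongrightarrow> 1"
proof -
  let ?x = "\<lambda>n::nat. real n powr (lam * \<alpha> - 1)"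
  have pos: "lam * (2 * \<alpha> - 1) > 0" using lam \<alpha> by simp
  have neg: "lam * \<alpha> - 1 < 0" using lam \<alpha> by (simp add: field_simps)
  have "?x \<longlonglongrightarrow> 0"
    using neg by (intro tendsto_neg_powr filterlim_real_sequentially)
  moreover have "(\<lambda>n. 1 / real n) \<longlonglongrightarrow> 0" by (rule lim_1_over_n)
  moreover have "(\<lambda>n. exp (- (real n powr (lam * (2 * \<alpha> - 1)) / 2))) \<longlonglongrightarrow> 0"
    using pos by real_asymp
  ultimately have "(\<lambda>n. (1 - exp (- (real n powr (lam * (2 * \<alpha> - 1)) / 2)))\<^sup>2
      * ((1 - 2 * ?x n + 1 / real n) * (1 - 2 * ?x n))) \<longlonglongrightarrow> (1 - 0)\<^sup>2 * ((1 - 2 * 0 + 0) * (1 - 2 * 0))"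
    by (intro tendsto_intros)
  then have lim: "(\<lambda>n. (1 - exp (- (real n powr (lam * (2 * \<alpha> - 1)) / 2)))\<^sup>2
      * ((1 - 2 * ?x n + 1 / real n) * (1 - 2 * ?x n))) \<longlonglongrightarrow> 1"
    by simp
  \<comment> \<open>The simplified form of the bound holds for n > 1, so the two sequences are
    identified from n = 2 onwards.\<close>
  have "eventually (\<lambda>n. order_bound (real n) (real n powr lam) \<alpha> =
      (1 - exp (- (real n powr (lam * (2 * \<alpha> - 1)) / 2)))\<^sup>2
      * ((1 - 2 * ?x n + 1 / real n) * (1 - 2 * ?x n))) sequentially"
    using eventually_ge_at_top[of 2]
  proof eventually_elim
    case (elim n)
    then have "real n powr (lam * \<alpha>) = real n * ?x n"
      by (simp add: powr_diff)
    then show ?case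
      using elim by (simp add: order_bound_eq powr_powr field_simps power2_eq_square)
  qed
  from tendsto_cong[OF this] lim show ?thesis by simp
qed

theorem mainTheorem2:
  fixes M :: "'w measure"
  shows "(\<forall>(n::nat) (m::nat) (lam::real) a b X Y.
            n \<ge> 2 \<and> lam > 0 \<and> real m = real n powr lam \<and> two_random_walks M n m a b X Y \<longrightarrow>
            (\<forall>\<alpha>::real. 1 / 2 < \<alpha> \<and> \<alpha> < min 1 (ln (real n / 2) / (lam * ln (real n))) \<longrightarrow>
               \<P>(\<omega> in M. a \<omega> < b \<omega> \<bar> walk_end a X m \<omega> < walk_end b Y m \<omega>)
                 \<ge> order_bound (real n) (real m) \<alpha>)) \<and>
         (\<forall>lam \<alpha> :: real. 0 < lam \<and> lam < 2 \<and> 1 / 2 < \<alpha> \<and> \<alpha> < min 1 (1 / lam) \<longrightarrow>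
            (\<lambda>n::nat. order_bound (real n) (real n powr lam) \<alpha>) \<longlonglongrightarrow> 1)"
  using cond_prob_ge_order_bound order_bound_tendsto_1 by auto

end
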